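(* Put $\Phi_0(y)=\dfrac{2}{1-y}$ and $\Psi_0(y)=\dfrac1{1-y}$. For every integer $s\ge1$, as formal power series in $y$, $$\Phi_s(y)=\frac{1+\Phi_{s-1}(y)}{1-y\,\Phi_{s-1}(y)},\qquad 1+y\,\Psi_s(y)=\frac{1+y\,\Psi_{s-1}(y)}{1-y\,\Phi_{s-1}(y)},$$ and $\Phi_1(y)=\dfrac{3-y}{1-3y}$. In particular, $\Phi_s(y)$ admits an iterative continued-fraction expansion, namely $\Phi_s=T^{\circ s}(\Phi_0)$, the $s$-fold iterate of $T(f)=\dfrac{1+f}{1-yf}$ applied to $\Phi_0$.
   Context: For integers $d\ge2$ and $s\ge1$ let $$\mathcal P_d^{(s)}=\{x=(x_1,\dots,x_d)\in\mathbb R_{\ge0}^d:\ x_i+x_{i+1}\le s+\delta_i,\ 1\le i\le d-1\},$$ where $\delta_i=0$ for $i$ odd and $\delta_i=1$ for $i$ even. Let $N_d(s):=\#(\mathcal P_d^{(s)}\cap\mathbb Z^d)$. For $s\ge1$ define the formal power series $$\Phi_s(y):=(s+2)+\sum_{m\ge1}N_{2m+1}(s)\,y^m,\qquad \Psi_s(y):=\sum_{m\ge0}N_{2m+2}(s)\,y^m$$ (the constant term $s+2$ of $\Phi_s$ is an auxiliary normalization). The series $\Phi_0,\Psi_0$ are the auxiliary initial values given in the claim. *)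

theory Defs
  imports Complex_Main "HOL-Library.FuncSet" "HOL-Computational_Algebra.Formal_Power_Series"
begin

definition delta :: "nat \<Rightarrow> nat" where
  "delta i = (if odd i then 0 else 1)"

text \<open>Points of \<open>d\<close>-dimensional space are functions on \<open>{1..d}\<close>, extensional (that is, equal to
  \<^const>\<open>undefined\<close> off \<open>{1..d}\<close>), so that distinct functions are distinct points.\<close>

definition polytope_P :: "nat \<Rightarrow> nat \<Rightarrow> (nat \<Rightarrow> real) set" where
  "polytope_P d s =
     {x \<in> {1..d} \<rightarrow>\<^sub>E {0..}. \<forall>i\<in>{1..<d}. x i + x (i + 1) \<le> real s + real (delta i)}"

definition lattice_points :: "nat \<Rightarrow> (nat \<Rightarrow> real) set" where
  "lattice_points d = {1..d} \<rightarrow>\<^sub>E \<int>"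

text \<open>For \<open>d \<ge> 2\<close> every coordinate of a point of the polytope is bounded, so the set counted here is
  finite; smaller \<open>d\<close> are never used.\<close>

definition N :: "nat \<Rightarrow> nat \<Rightarrow> nat" where
  "N d s = card (polytope_P d s \<inter> lattice_points d)"

text \<open>The values at \<open>s = 0\<close> are auxiliary initial values, not generating functions of \<open>N\<close>.\<close>

definition Phi :: "nat \<Rightarrow> rat fps" where
  "Phi s = (if s = 0 then 2 / (1 - fps_X)
            else Abs_fps (\<lambda>m. if m = 0 then of_nat s + 2 else of_nat (N (2 * m + 1) s)))"

definition Psi :: "nat \<Rightarrow> rat fps" where
  "Psi s = (if s = 0 then 1 / (1 - fps_X)
            else Abs_fps (\<lambda>m. of_nat (N (2 * m + 2) s)))"

text \<open>The denominator has constant term 1, hence is a unit, and the quotient is the usual one.\<close>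

definition T :: "rat fps \<Rightarrow> rat fps" where
  "T f = (1 + f) / (1 - fps_X * f)"

end

theory Submission imports Defs begin

text \<open>
  The two identities are the generating-function form of one decomposition, cutting a lattice
  point at its even coordinates that are zero.

  Replace the polytope by sequences of naturals \<open>x\<^sub>1, \<dots>, x\<^sub>n\<close> with the same constraints
  and the additional bound \<open>x\<^sub>1 \<le> s + 1\<close>. For \<open>n \<ge> 2\<close> the bound follows from
  \<open>x\<^sub>1 + x\<^sub>2 \<le> s\<close>, so these sequences are the lattice points; for \<open>n = 1\<close> there are
  \<open>s + 2\<close> of them, the normalization in \<open>\<Phi>\<^sub>s\<close>, and for \<open>n = 0\<close> there is one, the constant
  term of \<open>1 + y \<Psi>\<^sub>s\<close>. For \<open>s = 0\<close> all coordinates but an odd last one vanish, and the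
  numbers are the coefficients of \<open>\<Phi>\<^sub>0\<close> and \<open>1 + y \<Psi>\<^sub>0\<close>. So the coefficients of both series
  are given uniformly, for all \<open>s \<ge> 0\<close>, by one family of counts.

  Now let \<open>s = r + 1\<close>. If no even coordinate is zero, subtracting one from each of
  them turns the constraints for \<open>s\<close> into those for \<open>r\<close>. Otherwise let \<open>x\<^bsub>2k+2\<^esub>\<close> be the
  first even coordinate that is zero. The part before it has length \<open>2k + 1\<close> and, after the
  same subtraction, is a sequence for \<open>r\<close>. The zero imposes on the next coordinate only the bound
  \<open>s + 1\<close>, so the part after it is an arbitrary sequence for \<open>s\<close> of length \<open>n - 2k - 2\<close>.
  This is the lemma \<open>num_seqs_split\<close>, and summed over odd and even \<open>n\<close> it says
  \<open>\<Phi>\<^sub>s = 1 + \<Phi>\<^sub>r + y \<Phi>\<^sub>r \<Phi>\<^sub>s\<close> and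
  \<open>1 + y \<Psi>\<^sub>s = 1 + y \<Psi>\<^sub>r + y \<Phi>\<^sub>r (1 + y \<Psi>\<^sub>s)\<close>.
  The extra \<open>1\<close> in the first identity comes from \<open>n = 1\<close>, where \<open>s + 2 = (r + 2) + 1\<close>.
\<close>

section \<open>Counting sequences by their first two entries\<close>

text \<open>The number of sequences of length \<open>n\<close> that satisfy the constraints for \<open>s\<close> and have first
  entry at most \<open>u\<close>; see \<open>card_seqs\<close>. Removing two entries at a time keeps the parity of the
  positions, and a removed second entry \<open>b\<close> leaves the bound \<open>s + 1 - b\<close> on the next one.
  The index set of \<open>b\<close> is empty when \<open>a > s\<close>.\<close>

fun num_seqs :: "nat \<Rightarrow> nat \<Rightarrow> nat \<Rightarrow> nat" where
  "num_seqs s 0 u = 1"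
| "num_seqs s (Suc 0) u = u + 1"
| "num_seqs s (Suc (Suc n)) u = (\<Sum>a\<le>u. \<Sum>b<Suc s - a. num_seqs s n (Suc s - b))"

text \<open>The constraint on the first two entries implies that the first one is at most \<open>s\<close>.\<close>

lemma num_seqs_first_bound_redundant:
  "num_seqs s (Suc (Suc n)) (Suc s) = num_seqs s (Suc (Suc n)) s"
  by simp

lemma num_seqs_zero:
  "num_seqs 0 (2 * m) 1 = 1" "num_seqs 0 (2 * m + 1) 1 = 2"
  by (induction m) simp_all

text \<open>The split at the first zero among the even coordinates, for an arbitrary bound \<open>u\<close> on the
  first entry so that it can be proved by induction on the length. The hypothesis \<open>u \<le> r + 1\<close>
  comes from the case \<open>x\<^sub>2 = 0\<close>: there the constraint \<open>x\<^sub>1 \<le> r + 1\<close> must not exclude any of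
  the \<open>u + 1 = num_seqs r 1 u\<close> values of \<open>x\<^sub>1\<close> that the term \<open>k = 0\<close> counts. It is preserved by
  the induction, since after a nonzero second entry the next bound is at most \<open>r + 1\<close>.\<close>

lemma num_seqs_split:
  assumes "u \<le> Suc r"
  shows "num_seqs (Suc r) n u = num_seqs r n u
    + (\<Sum>k<n div 2. num_seqs r (2 * k + 1) u * num_seqs (Suc r) (n - 2 * k - 2) (Suc (Suc r)))"
  using assms
proof (induction n arbitrary: u rule: induct_nat_012)
  case (ge2 n)
  let ?s = "Suc r"
  let ?W = "\<lambda>j. num_seqs ?s j (Suc ?s)"
  \<comment> \<open>The entry \<open>b = 0\<close> gives the term \<open>k = 0\<close>; an entry \<open>b + 1\<close> becomes \<open>b\<close>.\<close>
  have "num_seqs ?s (Suc (Suc n)) u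
      = (\<Sum>a\<le>u. ?W n + (\<Sum>b<?s - a. num_seqs ?s n (?s - b)))"
    unfolding num_seqs.simps
  proof (rule sum.cong[OF refl])
    fix a assume "a \<in> {..u}"
    then have "Suc ?s - a = Suc (?s - a)" using ge2.prems by auto
    then show "(\<Sum>b<Suc ?s - a. num_seqs ?s n (Suc ?s - b))
        = ?W n + (\<Sum>b<?s - a. num_seqs ?s n (?s - b))"
      by (simp only: sum.lessThan_Suc_shift) simp
  qed
  also have "\<dots> = (u + 1) * ?W n + (\<Sum>a\<le>u. \<Sum>b<?s - a. num_seqs r n (?s - b)
      + (\<Sum>k<n div 2. num_seqs r (2 * k + 1) (?s - b) * ?W (n - 2 * k - 2)))"
    using ge2.IH(1)[of "?s - b" for b] by (simp add: sum.distrib)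
  also have "\<dots> = num_seqs r (Suc (Suc n)) u + (u + 1) * ?W n
      + (\<Sum>a\<le>u. \<Sum>b<?s - a. \<Sum>k<n div 2. num_seqs r (2 * k + 1) (?s - b) * ?W (n - 2 * k - 2))"
    by (simp add: sum.distrib)
  also have "(\<Sum>a\<le>u. \<Sum>b<?s - a. \<Sum>k<n div 2.
        num_seqs r (2 * k + 1) (?s - b) * ?W (n - 2 * k - 2))
      = (\<Sum>a\<le>u. \<Sum>k<n div 2. \<Sum>b<?s - a.
        num_seqs r (2 * k + 1) (?s - b) * ?W (n - 2 * k - 2))"
    by (intro sum.cong[OF refl] sum.swap)
  also have "\<dots> = (\<Sum>k<n div 2. \<Sum>a\<le>u. \<Sum>b<?s - a.
        num_seqs r (2 * k + 1) (?s - b) * ?W (n - 2 * k - 2))"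
    by (rule sum.swap)
  also have "\<dots> = (\<Sum>k<n div 2. num_seqs r (2 * Suc k + 1) u * ?W (Suc (Suc n) - 2 * Suc k - 2))"
    by (simp add: sum_distrib_right)
  also have "num_seqs r (Suc (Suc n)) u + (u + 1) * ?W n + \<dots> = num_seqs r (Suc (Suc n)) u
      + (\<Sum>k<Suc (n div 2). num_seqs r (2 * k + 1) u * ?W (Suc (Suc n) - 2 * k - 2))"
    by (simp only: sum.lessThan_Suc_shift) simp
  finally show ?case by simp
qed simp_all

section \<open>Lattice points of the polytope\<close>

text \<open>Position \<open>i\<close> of a list holds the coordinate \<open>i + 1\<close>, hence the argument of \<^const>\<open>delta\<close>.\<close>

definition seqs :: "nat \<Rightarrow> nat \<Rightarrow> nat \<Rightarrow> nat list set" where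
  "seqs s n u = {xs. length xs = n \<and> (n > 0 \<longrightarrow> xs ! 0 \<le> u) \<and>
     (\<forall>i. Suc i < n \<longrightarrow> xs ! i + xs ! Suc i \<le> s + delta (Suc i))}"

lemma seqs_0: "seqs s 0 u = {[]}"
  by (auto simp: seqs_def)

lemma seqs_1: "seqs s (Suc 0) u = (\<lambda>a. [a]) ` {..u}"
  by (auto simp: seqs_def length_Suc_conv)

lemma Cons_Cons_in_seqs:
  "a # b # xs \<in> seqs s (Suc (Suc n)) u \<longleftrightarrow> a \<le> u \<and> a + b \<le> s \<and> xs \<in> seqs s n (Suc s - b)"
proof -
  have "(\<forall>i. Q i) \<longleftrightarrow> Q 0 \<and> Q (Suc 0) \<and> (\<forall>i. Q (Suc (Suc i)))" for Q :: "nat \<Rightarrow> bool"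
    by (metis not0_implies_Suc)
  from this[of "\<lambda>i. Suc i < Suc (Suc n) \<longrightarrow> P i" for P]
  have split: "(\<forall>i. Suc i < Suc (Suc n) \<longrightarrow> P i) \<longleftrightarrow>
      P 0 \<and> (n > 0 \<longrightarrow> P (Suc 0)) \<and> (\<forall>i. Suc i < n \<longrightarrow> P (Suc (Suc i)))"
    for P :: "nat \<Rightarrow> bool"
    by simp
  have delta: "delta (Suc 0) = 0" "delta (Suc (Suc 0)) = 1"
    "delta (Suc (Suc (Suc i))) = delta (Suc i)" for i
    by (simp_all add: delta_def)
  have bound: "a + b \<le> s \<Longrightarrow> b + xs ! 0 \<le> s + 1 \<longleftrightarrow> xs ! 0 \<le> Suc s - b"
    by linarith
  show ?thesis
    unfolding seqs_def mem_Collect_eq split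
    by (simp only: delta length_Cons nth_Cons_0 nth_Cons_Suc nat.inject zero_less_Suc simp_thms
        add_0_right) (use bound in blast)
qed

lemma seqs_Suc_Suc:
  "seqs s (Suc (Suc n)) u = (\<lambda>(a, b, xs). a # b # xs) `
     (SIGMA a:{..u}. SIGMA b:{..<Suc s - a}. seqs s n (Suc s - b))"
proof (rule set_eqI)
  fix ys
  show "ys \<in> seqs s (Suc (Suc n)) u \<longleftrightarrow> ys \<in> (\<lambda>(a, b, xs). a # b # xs) `
     (SIGMA a:{..u}. SIGMA b:{..<Suc s - a}. seqs s n (Suc s - b))"
  proof (cases "\<exists>a b xs. ys = a # b # xs")
    case True
    then obtain a b xs where ys: "ys = a # b # xs" by blast
    show ?thesis unfolding ys Cons_Cons_in_seqs by (auto simp: image_iff)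
  next
    case False
    then have "ys \<notin> seqs s (Suc (Suc n)) u"
      by (auto simp: seqs_def length_Suc_conv)
    with False show ?thesis by auto
  qed
qed

lemma finite_card_seqs: "finite (seqs s n u) \<and> card (seqs s n u) = num_seqs s n u"
proof (induction n arbitrary: u rule: induct_nat_012)
  case (ge2 n)
  then show ?case
    by (auto simp: seqs_Suc_Suc card_image inj_on_def)
qed (simp_all add: seqs_0 seqs_1 card_image inj_on_def)

lemmas card_seqs = finite_card_seqs[THEN conjunct2]

text \<open>The bound \<open>s + 1\<close> on the first entry excludes no lattice point, because \<open>d \<ge> 2\<close> gives
  \<open>x\<^sub>1 \<le> s\<close>.\<close>

lemma N_eq_num_seqs:
  assumes "d \<ge> 2"
  shows "N d s = num_seqs s d (Suc s)"
proof -
  let ?f = "\<lambda>xs. \<lambda>i\<in>{1..d}. real (xs ! (i - 1))"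
  let ?A = "seqs s d (Suc s)" and ?B = "polytope_P d s \<inter> lattice_points d"
  have "bij_betw ?f ?A ?B"
  proof (rule bij_betw_imageI)
    show "inj_on ?f ?A"
    proof (rule inj_onI)
      fix xs ys assume *: "xs \<in> ?A" "ys \<in> ?A" "?f xs = ?f ys"
      have "xs ! i = ys ! i" if "i < d" for i
        using fun_cong[OF *(3), of "Suc i"] that by simp
      with * show "xs = ys" by (auto simp: seqs_def intro: nth_equalityI)
    qed
    show "?f ` ?A = ?B"
    proof (intro equalityI subsetI)
      fix x assume "x \<in> ?f ` ?A"
      then obtain xs where xs: "xs \<in> ?A" and x: "x = ?f xs" by blast
      have "x i + x (i + 1) \<le> real s + real (delta i)" if i: "i \<in> {1..<d}" for i
      proof -
        have "xs ! (i - 1) + xs ! i \<le> s + delta i"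
          using xs i by (auto simp: seqs_def dest!: spec[of _ "i - 1"])
        then have "real (xs ! (i - 1)) + real (xs ! i) \<le> real s + real (delta i)"
          by (metis of_nat_add of_nat_le_iff)
        with i show ?thesis by (simp add: x)
      qed
      then show "x \<in> ?B"
        by (auto simp: polytope_P_def lattice_points_def x)
    next
      fix x assume x: "x \<in> ?B"
      define xs where "xs = map (\<lambda>i. nat \<lfloor>x (Suc i)\<rfloor>) [0..<d]"
      have nth: "real (xs ! i) = x (Suc i)" if "i < d" for i
      proof -
        have "x (Suc i) \<in> \<int>" "x (Suc i) \<ge> 0"
          using x that by (auto simp: polytope_P_def lattice_points_def PiE_iff)
        then show ?thesis using that by (auto simp: xs_def elim!: Ints_cases)
      qed
      have step: "xs ! i + xs ! Suc i \<le> s + delta (Suc i)" if "Suc i < d" for i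
      proof -
        have "x (Suc i) + x (Suc i + 1) \<le> real s + real (delta (Suc i))"
          using x that by (auto simp: polytope_P_def)
        then have "real (xs ! i + xs ! Suc i) \<le> real (s + delta (Suc i))"
          using nth[of i] nth[of "Suc i"] that by simp
        then show ?thesis by linarith
      qed
      have "xs ! 0 \<le> Suc s"
        using step[of 0] assms by (simp add: delta_def)
      moreover have "length xs = d" by (simp add: xs_def)
      ultimately have "xs \<in> ?A" using step by (simp add: seqs_def)
      moreover have "x = ?f xs"
      proof
        fix i
        show "x i = ?f xs i"
        proof (cases "i \<in> {1..d}")
          case True
          then show ?thesis using nth[of "i - 1"] by auto
        next
          case False
          have "x \<in> {1..d} \<rightarrow>\<^sub>E \<int>" using x by (simp add: lattice_points_def)
          then have "x i = undefined" using False by (rule PiE_arb)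
          then show ?thesis unfolding restrict_def using False by (simp only: if_False)
        qed
      qed
      ultimately show "x \<in> ?f ` ?A" by blast
    qed
  qed
  then have "card ?A = card ?B" by (rule bij_betw_same_card)
  then show ?thesis by (simp add: N_def card_seqs)
qed

section \<open>The generating functions\<close>

unbundle fps_syntax

lemma one_minus_X_ne_0: "1 - fps_X * f \<noteq> 0" for f :: "rat fps"
proof
  assume "1 - fps_X * f = 0"
  then have "(1 - fps_X * f) $ 0 = 0" by simp
  then show False by simp
qed

lemma fps_eq_divideI: "f * (1 - fps_X * h) = g \<Longrightarrow> f = g / (1 - fps_X * h)" for f g h :: "rat fps"
  using one_minus_X_ne_0[of h] by (metis nonzero_mult_div_cancel_right)

lemma fps_eq_divideI_fixpoint:
  fixes f g h :: "rat fps"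
  assumes "f = g + fps_X * (h * f)"
  shows "f = g / (1 - fps_X * h)"
proof (rule fps_eq_divideI)
  have "f * (1 - fps_X * h) = f - fps_X * (h * f)"
    by (simp add: algebra_simps)
  also have "\<dots> = g"
    using assms by (metis add_diff_cancel_right')
  finally show "f * (1 - fps_X * h) = g" .
qed

lemma one_minus_X_mult_const: "(1 - fps_X) * Abs_fps (\<lambda>_. c) = fps_const c" for c :: rat
  by (rule fps_ext) (simp add: left_diff_distrib)

lemma divide_one_minus_X: "fps_const c / (1 - fps_X) = Abs_fps (\<lambda>_. c)" for c :: rat
  using fps_eq_divideI[of "Abs_fps (\<lambda>_. c)" 1 "fps_const c"] one_minus_X_mult_const[of c]
  by (simp add: mult.commute)

lemma Phi_0: "Phi 0 = Abs_fps (\<lambda>_. 2)"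
  using divide_one_minus_X[of 2] by (simp add: Phi_def numeral_fps_const)

lemma Psi_0: "Psi 0 = Abs_fps (\<lambda>_. 1)"
  using divide_one_minus_X[of 1] by (simp add: Psi_def)

lemma Phi_nth: "Phi s $ m = of_nat (num_seqs s (2 * m + 1) (Suc s))"
proof (cases "s = 0")
  case True
  then show ?thesis using num_seqs_zero(2)[of m] by (simp add: Phi_0)
next
  case False
  show ?thesis
  proof (cases m)
    case 0
    then show ?thesis using False by (simp add: Phi_def)
  next
    case (Suc k)
    then show ?thesis using False N_eq_num_seqs[of "2 * m + 1" s] by (simp add: Phi_def)
  qed
qed

lemma Psi_nth: "(1 + fps_X * Psi s) $ m = of_nat (num_seqs s (2 * m) (Suc s))"
proof (cases m)
  case (Suc k)
  show ?thesis
  proof (cases "s = 0")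
    case True
    then show ?thesis using num_seqs_zero(1)[of m] Suc by (simp add: Psi_0)
  next
    case False
    then show ?thesis using Suc N_eq_num_seqs[of "2 * m" s] by (simp add: Psi_def)
  qed
qed simp

text \<open>The products in the next two identities count the sequences with a zero at an even position:
  the factor \<^term>\<open>Phi r\<close> is the part before the first such zero, which has odd length, and
  \<^term>\<open>fps_X\<close> accounts for the zero and for the shift from lengths \<open>2k + 1\<close> to exponents
  \<open>k\<close>.\<close>

lemma Phi_Suc: "Phi (Suc r) = 1 + Phi r + fps_X * (Phi r * Phi (Suc r))"
proof (rule fps_ext)
  fix m
  show "Phi (Suc r) $ m = (1 + Phi r + fps_X * (Phi r * Phi (Suc r))) $ m"
  proof (cases m)
    case 0
    then show ?thesis by (simp add: Phi_nth)
  next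
    case (Suc k)
    have "num_seqs (Suc r) (2 * m + 1) (Suc (Suc r)) = num_seqs (Suc r) (2 * m + 1) (Suc r)"
      using num_seqs_first_bound_redundant[of "Suc r" "2 * k + 1"] Suc by simp
    also have "\<dots> = num_seqs r (2 * m + 1) (Suc r) + (\<Sum>i=0..k. num_seqs r (2 * i + 1) (Suc r)
        * num_seqs (Suc r) (2 * m + 1 - 2 * i - 2) (Suc (Suc r)))"
      by (subst num_seqs_split)
        (simp_all add: Suc atLeast0AtMost lessThan_Suc_atMost del: num_seqs.simps)
    also have "\<dots> = num_seqs r (2 * m + 1) (Suc r) + (\<Sum>i=0..k. num_seqs r (2 * i + 1) (Suc r)
        * num_seqs (Suc r) (2 * (k - i) + 1) (Suc (Suc r)))"
    proof -
      have "2 * m + 1 - 2 * i - 2 = 2 * (k - i) + 1" if "i \<in> {0..k}" for i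
        using that Suc by auto
      then show ?thesis by simp
    qed
    finally have "Phi (Suc r) $ m = Phi r $ m + (Phi r * Phi (Suc r)) $ k"
      by (simp only: Phi_nth fps_mult_nth of_nat_add of_nat_sum of_nat_mult)
    then show ?thesis using Suc by simp
  qed
qed

lemma Psi_Suc:
  "1 + fps_X * Psi (Suc r) = 1 + fps_X * Psi r + fps_X * (Phi r * (1 + fps_X * Psi (Suc r)))"
  (is "?G (Suc r) = ?G r + fps_X * (Phi r * ?G (Suc r))")
proof (rule fps_ext)
  fix m
  show "?G (Suc r) $ m = (?G r + fps_X * (Phi r * ?G (Suc r))) $ m"
  proof (cases m)
    case 0
    then show ?thesis by simp
  next
    case (Suc k)
    have "num_seqs (Suc r) (2 * m) (Suc (Suc r)) = num_seqs (Suc r) (2 * m) (Suc r)"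
      using num_seqs_first_bound_redundant[of "Suc r" "2 * k"] Suc by simp
    also have "\<dots> = num_seqs r (2 * m) (Suc r) + (\<Sum>i=0..k. num_seqs r (2 * i + 1) (Suc r)
        * num_seqs (Suc r) (2 * m - 2 * i - 2) (Suc (Suc r)))"
      by (subst num_seqs_split)
        (simp_all add: Suc atLeast0AtMost lessThan_Suc_atMost del: num_seqs.simps)
    also have "\<dots> = num_seqs r (2 * m) (Suc r) + (\<Sum>i=0..k. num_seqs r (2 * i + 1) (Suc r)
        * num_seqs (Suc r) (2 * (k - i)) (Suc (Suc r)))"
    proof -
      have "2 * m - 2 * i - 2 = 2 * (k - i)" if "i \<in> {0..k}" for i
        using that Suc by auto
      then show ?thesis by simp
    qed
    finally have "?G (Suc r) $ m = ?G r $ m + (Phi r * ?G (Suc r)) $ k"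
      by (simp only: Psi_nth Phi_nth fps_mult_nth of_nat_add of_nat_sum of_nat_mult)
    then show ?thesis
      using Suc by (simp only: fps_add_nth fps_X_mult_nth) simp
  qed
qed

lemma Phi_Suc_eq_T: "Phi (Suc r) = T (Phi r)"
  unfolding T_def by (rule fps_eq_divideI_fixpoint) (rule Phi_Suc)

lemma Psi_Suc_eq_divide:
  "1 + fps_X * Psi (Suc r) = (1 + fps_X * Psi r) / (1 - fps_X * Phi r)"
  by (rule fps_eq_divideI_fixpoint) (rule Psi_Suc)

text \<open>The recurrence for \<open>r = 0\<close>, multiplied by the denominator \<open>1 - y\<close> of \<open>\<Phi>\<^sub>0\<close>.\<close>

lemma Phi_1: "Phi 1 = (3 - fps_X) / (1 - 3 * fps_X)"
proof -
  have Phi_0_eq: "(1 - fps_X) * Phi 0 = 2"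
    using one_minus_X_mult_const[of 2] by (simp add: Phi_0 numeral_fps_const)
  have "(1 - fps_X) * Phi 1 = (1 - fps_X) * (1 + Phi 0 + fps_X * (Phi 0 * Phi 1))"
    using Phi_Suc[of 0] by (metis One_nat_def)
  also have "\<dots> = (1 - fps_X) + (1 - fps_X) * Phi 0 + fps_X * ((1 - fps_X) * Phi 0 * Phi 1)"
    by (simp add: algebra_simps)
  also have "\<dots> = 3 - fps_X + 2 * fps_X * Phi 1"
    unfolding Phi_0_eq by simp
  finally have "Phi 1 * (1 - fps_X * 3) = 3 - fps_X"
    by (simp add: algebra_simps)
  from fps_eq_divideI[OF this] show ?thesis by (simp add: mult.commute)
qed

lemma Phi_eq_iterate: "Phi s = (T ^^ s) (Phi 0)"
  by (induction s) (simp_all add: Phi_Suc_eq_T)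

theorem theorem1p2:
  "(\<forall>s\<ge>1. Phi s = (1 + Phi (s - 1)) / (1 - fps_X * Phi (s - 1)) \<and>
          1 + fps_X * Psi s = (1 + fps_X * Psi (s - 1)) / (1 - fps_X * Phi (s - 1))) \<and>
   Phi 1 = (3 - fps_X) / (1 - 3 * fps_X) \<and>
   (\<forall>s\<ge>1. Phi s = (T ^^ s) (Phi 0))"
proof (intro conjI allI impI)
  fix s :: nat assume "s \<ge> 1"
  then obtain r where s: "s = Suc r" by (cases s) auto
  show "Phi s = (1 + Phi (s - 1)) / (1 - fps_X * Phi (s - 1))"
    unfolding s diff_Suc_1 using Phi_Suc_eq_T[of r] unfolding T_def .
  show "1 + fps_X * Psi s = (1 + fps_X * Psi (s - 1)) / (1 - fps_X * Phi (s - 1))"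
    unfolding s diff_Suc_1 by (rule Psi_Suc_eq_divide)
qed (rule Phi_1, rule Phi_eq_iterate)

end
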